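(* Let $\mathcal{A}$ be a Banach algebra, let $\mathcal{B}$ be a commutative semisimple Banach algebra, and let $\varphi:\mathcal{A}\to\mathcal{B}$ be a mixed Jordan homomorphism. Then $\varphi$ is continuous.
   Context: Banach algebras are complex and associative. A mixed Jordan homomorphism is a linear map $\varphi:\mathcal{A}\to\mathcal{B}$ with $\varphi(a^2b)=\varphi(a)^2\varphi(b)$ for all $a,b\in\mathcal{A}$; continuity is not assumed. Semisimple means that the Jacobson radical is trivial. *)

theory Defs
  imports "HOL-Analysis.Analysis"
begin

(* HOL-Analysis only has real Banach algebras (class real_normed_algebra together with banach,
   neither of which assumes a multiplicative unit), so the complex structure is added here.
   The norm is submultiplicative by the inherited axiom norm_mult_ineq. *)

class complex_banach_algebra = real_normed_algebra + banach +
  fixes scaleC :: "complex \<Rightarrow> 'a \<Rightarrow> 'a"  (infixr "*\<^sub>C" 75)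
  assumes scaleC_add_right: "c *\<^sub>C (x + y) = c *\<^sub>C x + c *\<^sub>C y"
    and scaleC_add_left: "(c + d) *\<^sub>C x = c *\<^sub>C x + d *\<^sub>C x"
    and scaleC_scaleC: "c *\<^sub>C (d *\<^sub>C x) = (c * d) *\<^sub>C x"
    and scaleC_one: "1 *\<^sub>C x = x"
    and scaleC_of_real: "complex_of_real r *\<^sub>C x = r *\<^sub>R x"
    and mult_scaleC_left: "(c *\<^sub>C x) * y = c *\<^sub>C (x * y)"
    and mult_scaleC_right: "x * (c *\<^sub>C y) = c *\<^sub>C (x * y)"
    and norm_scaleC: "norm (c *\<^sub>C x) = cmod c * norm x"

global_interpretation complex_vector: vector_space "scaleC :: complex \<Rightarrow> 'a \<Rightarrow> 'a::complex_banach_algebra"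
  by unfold_locales (simp_all add: scaleC_add_right scaleC_add_left scaleC_scaleC scaleC_one)

definition left_ideal :: "'a::complex_banach_algebra set \<Rightarrow> bool" where
  "left_ideal I \<longleftrightarrow> complex_vector.subspace I \<and> (\<forall>a. \<forall>x\<in>I. a * x \<in> I)"

definition modular_left_ideal :: "'a::complex_banach_algebra set \<Rightarrow> bool" where
  "modular_left_ideal I \<longleftrightarrow> left_ideal I \<and> (\<exists>u. \<forall>a. a - a * u \<in> I)"

definition maximal_modular_left_ideal :: "'a::complex_banach_algebra set \<Rightarrow> bool" where
  "maximal_modular_left_ideal M \<longleftrightarrow>
     modular_left_ideal M \<and> M \<noteq> UNIV \<and> (\<forall>I. left_ideal I \<and> M \<subseteq> I \<longrightarrow> I = M \<or> I = UNIV)"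

(* The usual definition for algebras that need not be unital; it is the whole algebra if
   there are no maximal modular left ideals. *)
definition jacobson_radical :: "'a::complex_banach_algebra set" where
  "jacobson_radical = \<Inter> {M. maximal_modular_left_ideal M}"

(* The type argument names the algebra. *)
definition semisimple :: "'a::complex_banach_algebra itself \<Rightarrow> bool" where
  "semisimple _ \<longleftrightarrow> (jacobson_radical :: 'a set) = {0}"

(* a * a is written out because the power operation is only available with a unit. *)
definition mixed_jordan_homomorphism ::
    "('a::complex_banach_algebra \<Rightarrow> 'b::complex_banach_algebra) \<Rightarrow> bool" where
  "mixed_jordan_homomorphism \<phi> \<longleftrightarrow>
     Vector_Spaces.linear scaleC scaleC \<phi> \<and> (\<forall>a b. \<phi> ((a * a) * b) = (\<phi> a * \<phi> a) * \<phi> b)"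

end

theory Submission
  imports Defs
begin

text \<open>
  Write \<open>S\<close> for the separating space of \<open>\<phi>\<close>, the set of all limits of sequences \<open>\<phi> (X n)\<close> with \<open>X n\<close>
  tending to 0. By the closed graph theorem it suffices that \<open>S\<close> is trivial, and since the codomain is
  semisimple it suffices that \<open>S\<close> lies in every maximal modular ideal \<open>M\<close>.

  The algebraic identity controls spectra without any continuity. If \<open>a\<close> has norm less than 1, every
  \<open>c\<close> can be written as \<open>b - a * a * b\<close> by a Neumann series, so that \<open>\<phi> c = (1 - x * x) * \<phi> b\<close> with
  \<open>x = \<phi> a\<close>. For \<open>c = a\<close> this shows that \<open>x\<close> is divisible by \<open>1 - x * x\<close>, so \<open>1 - x * x\<close> also divides
  \<open>1 = (1 - x * x) + x * x\<close> and is invertible. Applied to complex multiples of \<open>a\<close>, this bounds the spectrum of \<open>x * x\<close> by the square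
  of the norm of \<open>a\<close> (\<open>mixed_jordan_quasi_inverse\<close>). The spectral radius formula, here in the form of a
  Cauchy estimate for the resolvent, turns it into a bound for the norms of the powers of \<open>x * x\<close>
  (\<open>cauchy_estimate_powers\<close>).

  Now let \<open>b\<close> in \<open>S\<close> lie outside \<open>M\<close>. Then \<open>b\<close> is invertible modulo \<open>M\<close>: some \<open>d\<close> satisfies
  \<open>(1 - b * d) * y \<in> M\<close> for all \<open>y\<close>. Write \<open>b = x + e\<close> where \<open>x = \<phi> (X n)\<close> with \<open>X n\<close> small and \<open>e\<close> small.
  With \<open>g = (1 - e * d)\<^sup>-\<^sup>1 * d\<close> one has \<open>1 - b * d = (1 - e * d) * (1 - x * g)\<close>. The first factor is
  invertible because \<open>e * d\<close> is small. The second divides \<open>1 - x * x * (g * g)\<close>, whose Neumann series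
  converges because \<open>g\<close> stays bounded while the powers of \<open>x * x\<close> decay as fast as desired. Hence
  \<open>1 - b * d\<close> is invertible and \<open>M\<close> is everything, a contradiction
  (\<open>separating_space_subset_maximal_modular_ideal\<close>).

  The algebras need not have a unit. So "\<open>1 - h\<close> is invertible" is expressed either by solvability of
  \<open>v - h * v = z\<close> for every \<open>z\<close>, or by a quasi-inverse \<open>p = h + h * p\<close>, meaning \<open>1 + p = (1 - h)\<^sup>-\<^sup>1\<close>;
  and the powers of \<open>h\<close> appear as iterates of multiplication by \<open>h\<close>.
\<close>

section \<open>Complex scalar multiplication\<close>

lemma bounded_bilinear_scaleC:
  "bounded_bilinear (scaleC :: complex \<Rightarrow> 'a \<Rightarrow> 'a::complex_banach_algebra)"
proof (rule bounded_bilinear.intro)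
  fix a b :: complex and x y :: 'a and r :: real
  show "(a + b) *\<^sub>C x = a *\<^sub>C x + b *\<^sub>C x" by (rule scaleC_add_left)
  show "a *\<^sub>C (x + y) = a *\<^sub>C x + a *\<^sub>C y" by (rule scaleC_add_right)
  show "(r *\<^sub>R a) *\<^sub>C x = r *\<^sub>R (a *\<^sub>C x)"
    by (simp add: scaleR_conv_of_real scaleC_scaleC flip: scaleC_of_real)
  show "a *\<^sub>C (r *\<^sub>R x) = r *\<^sub>R (a *\<^sub>C x)"
    by (simp add: scaleC_scaleC mult.commute flip: scaleC_of_real)
  show "\<exists>K. \<forall>c (z::'a). norm (c *\<^sub>C z) \<le> norm c * norm z * K"
    by (rule exI[of _ 1]) (simp add: norm_scaleC)
qed

interpretation scaleC: bounded_bilinear "scaleC :: complex \<Rightarrow> 'a \<Rightarrow> 'a::complex_banach_algebra"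
  by (rule bounded_bilinear_scaleC)

section \<open>The quasi-resolvent and its Cauchy estimate\<close>

text \<open>
  With \<open>1 + p = (1 - w q)\<^sup>-\<^sup>1\<close> and \<open>1 + p' = (1 - z q)\<^sup>-\<^sup>1\<close> this is the usual resolvent identity
  \<open>(1 - z q)\<^sup>-\<^sup>1 - (1 - w q)\<^sup>-\<^sup>1 = (z - w) q (1 - w q)\<^sup>-\<^sup>1 (1 - z q)\<^sup>-\<^sup>1\<close>, multiplied out.
\<close>
lemma resolvent_identity:
  fixes q :: "'b::{complex_banach_algebra, comm_ring}"
  assumes p: "p = w *\<^sub>C (q + q * p)" and p': "p' = z *\<^sub>C (q + q * p')"
  shows "p' - p = (z - w) *\<^sub>C (q + q * p + q * p' + q * p * p')"
proof -
  let ?S = "q + q * p + q * p' + q * p * p'"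
  have "w *\<^sub>C ?S = w *\<^sub>C (q + q * p) + w *\<^sub>C (q + q * p) * p'"
    by (simp add: scaleC_add_right algebra_simps mult_scaleC_left mult_scaleC_right)
  then have 1: "w *\<^sub>C ?S = p + p * p'"
    using p by simp
  have "z *\<^sub>C ?S = z *\<^sub>C (q + q * p') + z *\<^sub>C (q + q * p') * p"
    by (simp add: scaleC_add_right algebra_simps mult_scaleC_left mult_scaleC_right)
  then have 2: "z *\<^sub>C ?S = p' + p' * p"
    using p' by simp
  show ?thesis
    unfolding complex_vector.scale_left_diff_distrib 1 2 by (simp add: mult.commute)
qed

text \<open>
  The resolvent identity bounds \<open>P z - P w\<close> by a small multiple of \<open>1 + norm (P z)\<close>. Near \<open>w\<close> the factor
  is at most one half, so \<open>P z\<close> can be absorbed into the left-hand side: \<open>P\<close> is bounded near \<open>w\<close>, and then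
  continuous at \<open>w\<close>.
\<close>
lemma continuous_quasi_resolvent:
  fixes q :: "'b::{complex_banach_algebra, comm_ring}"
  assumes P: "\<And>w. cmod w < R \<Longrightarrow> P w = w *\<^sub>C (q + q * P w)" and w: "cmod w < R"
  shows "isCont P w"
proof -
  define a where "a = q + q * P w"
  have diff: "P z - P w = (z - w) *\<^sub>C (a + a * P z)" if "cmod z < R" for z
    using resolvent_identity[OF P[OF w] P[OF that]] by (simp add: a_def algebra_simps)
  have "((\<lambda>z. cmod (z - w) * norm a) \<longlongrightarrow> cmod (w - w) * norm a) (at w)"
    by (intro tendsto_intros)
  then have small: "\<forall>\<^sub>F z in at w. cmod (z - w) * norm a < 1/2"
    by (rule order_tendstoD) simp
  have "((\<lambda>z. cmod z) \<longlongrightarrow> cmod w) (at w)"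
    by (intro tendsto_intros)
  then have near: "\<forall>\<^sub>F z in at w. cmod z < R"
    using w by (rule order_tendstoD)
  have bound: "\<forall>\<^sub>F z in at w. norm (P z - P w) \<le> cmod (z - w) * norm a * (2 + 2 * norm (P w))"
    using small near
  proof eventually_elim
    case (elim z)
    let ?t = "cmod (z - w) * norm a"
    have "norm (a + a * P z) \<le> norm a + norm a * norm (P z)"
      by (metis norm_triangle_le add_left_mono norm_mult_ineq)
    then have "cmod (z - w) * norm (a + a * P z) \<le> cmod (z - w) * (norm a + norm a * norm (P z))"
      by (intro mult_left_mono) auto
    then have le: "norm (P z - P w) \<le> ?t * (1 + norm (P z))"
      unfolding diff[OF elim(2)] norm_scaleC by (simp add: algebra_simps)
    also have "\<dots> \<le> 1/2 * (1 + norm (P z))"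
      using elim(1) by (intro mult_right_mono) auto
    finally have "norm (P z) \<le> 1 + 2 * norm (P w)"
      using norm_triangle_sub[of "P z" "P w"] by simp
    then have "?t * (1 + norm (P z)) \<le> ?t * (2 + 2 * norm (P w))"
      by (intro mult_left_mono) auto
    with le show ?case by linarith
  qed
  have "((\<lambda>z. cmod (z - w) * norm a * (2 + 2 * norm (P w))) \<longlongrightarrow>
      cmod (w - w) * norm a * (2 + 2 * norm (P w))) (at w)"
    by (intro tendsto_intros)
  then have "((\<lambda>z. P z - P w) \<longlongrightarrow> 0) (at w)"
    using bound by (intro Lim_null_comparison[OF bound]) simp
  then show ?thesis
    by (simp add: isCont_def LIM_zero_iff)
qed

lemma has_derivative_quasi_resolvent:
  fixes q :: "'b::{complex_banach_algebra, comm_ring}"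
  assumes P: "\<And>w. cmod w < R \<Longrightarrow> P w = w *\<^sub>C (q + q * P w)" and w: "cmod w < R"
  shows "(P has_derivative (\<lambda>h. h *\<^sub>C (q + q * P w + q * P w + q * P w * P w))) (at w)"
proof -
  define D where "D z = q + q * P w + q * P z + q * P w * P z" for z
  have "((\<lambda>z. cmod z) \<longlongrightarrow> cmod w) (at w)"
    by (intro tendsto_intros)
  then have near: "\<forall>\<^sub>F z in at w. cmod z < R"
    using w by (rule order_tendstoD)
  have eq: "\<forall>\<^sub>F z in at w. norm (D z - D w) = norm (P z - P w - (z - w) *\<^sub>C D w) / norm (z - w)"
    using near eventually_at_ball'[of 1 w UNIV, simplified]
  proof eventually_elim
    case (elim z)
    have "P z - P w = (z - w) *\<^sub>C D z"
      unfolding D_def by (rule resolvent_identity[OF P[OF w] P[OF elim(1)]])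
    then have "P z - P w - (z - w) *\<^sub>C D w = (z - w) *\<^sub>C (D z - D w)"
      by (simp add: complex_vector.scale_right_diff_distrib)
    then show ?case
      using elim(2) by (simp add: norm_scaleC)
  qed
  have lim: "(P \<longlongrightarrow> P w) (at w)"
    using continuous_quasi_resolvent[OF P w] by (simp add: isCont_def)
  have "(D \<longlongrightarrow> D w) (at w)"
    unfolding D_def by (intro tendsto_intros lim)
  then have "((\<lambda>z. norm (D z - D w)) \<longlongrightarrow> 0) (at w)"
    by (simp add: LIM_zero tendsto_norm_zero)
  then have "((\<lambda>z. norm (P z - P w - (z - w) *\<^sub>C D w) / norm (z - w)) \<longlongrightarrow> 0) (at w)"
    by (rule Lim_transform_eventually) (rule eq)
  then have "(P has_derivative (\<lambda>h. h *\<^sub>C D w)) (at w)"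
    by (simp add: has_derivative_iff_norm scaleC.bounded_linear_left)
  then show ?thesis
    by (simp add: D_def)
qed

text \<open>
  A holomorphic function has the same mean over all circles around 0. Indeed, the derivative of
  \<open>P (s * cis t)\<close> with respect to \<open>t\<close> is \<open>\<i> * s\<close> times its derivative with respect to \<open>s\<close>, and it integrates
  to zero over a period; so the mean does not depend on \<open>s\<close>. Working directly with the vector-valued
  integral avoids functionals and the Hahn-Banach theorem.
\<close>
lemma circle_mean_value_zero:
  fixes P :: "complex \<Rightarrow> 'a::complex_banach_algebra"
  assumes der: "\<And>w. cmod w < R \<Longrightarrow> (P has_derivative (\<lambda>h. h *\<^sub>C D w)) (at w)"
    and contD: "continuous_on (ball 0 R) D" and zero: "P 0 = 0" and r: "0 \<le> r" "r < R"
  shows "integral {0..2*pi} (\<lambda>t. P (of_real r * cis t)) = 0"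
proof -
  have contP: "continuous_on (ball 0 R) P"
    by (rule has_derivative_continuous_on, rule has_derivative_at_withinI, rule der) simp
  have inside: "of_real s * cis t \<in> ball 0 R" if "s \<in> {0..r}" for s t
    using that r by (simp add: norm_mult)
  have der_s: "((\<lambda>s. P (of_real s * cis t)) has_vector_derivative cis t *\<^sub>C D (of_real s * cis t))
      (at s within {0..r})" if "s \<in> {0..r}" for s t
  proof -
    have "((\<lambda>s. of_real s * cis t) has_vector_derivative cis t) (at s within {0..r})"
      by (auto intro!: derivative_eq_intros)
    then have "(P \<circ> (\<lambda>s. of_real s * cis t) has_derivative (\<lambda>h. h *\<^sub>C D (of_real s * cis t)) \<circ> (\<lambda>h. h *\<^sub>R cis t))
        (at s within {0..r})"
      unfolding has_vector_derivative_def
      by (rule diff_chain_within) (rule has_derivative_at_withinI, rule der, use inside[OF that] in simp)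
    then show ?thesis
      by (simp add: has_vector_derivative_def o_def scaleC.scaleR_left)
  qed
  have der_t: "((\<lambda>t. P (of_real s * cis t)) has_vector_derivative (\<i> * of_real s * cis t) *\<^sub>C D (of_real s * cis t))
      (at t within {0..2*pi})" if "s \<in> {0..r}" for s t
  proof -
    have "((\<lambda>t. of_real s * cis t) has_vector_derivative (\<i> * of_real s * cis t)) (at t within {0..2*pi})"
      unfolding has_vector_derivative_def
      by (auto intro!: derivative_eq_intros simp: scaleR_conv_of_real algebra_simps)
    then have "(P \<circ> (\<lambda>t. of_real s * cis t) has_derivative
        (\<lambda>h. h *\<^sub>C D (of_real s * cis t)) \<circ> (\<lambda>h. h *\<^sub>R (\<i> * of_real s * cis t))) (at t within {0..2*pi})"
      unfolding has_vector_derivative_def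
      by (rule diff_chain_within) (rule has_derivative_at_withinI, rule der, use inside[OF that] in simp)
    then show ?thesis
      by (simp add: has_vector_derivative_def o_def scaleC.scaleR_left)
  qed
  define m where "m s = integral (cbox 0 (2*pi)) (\<lambda>t. P (of_real s * cis t))" for s
  have cont_s: "continuous_on {0..2*pi} (\<lambda>t. D (of_real s * cis t))" if "s \<in> {0..r}" for s
    by (rule continuous_on_compose2[OF contD]) (use inside[OF that] in \<open>auto intro!: continuous_intros\<close>)
  have der_m: "(m has_vector_derivative integral (cbox 0 (2*pi)) (\<lambda>t. cis t *\<^sub>C D (of_real s * cis t)))
      (at s within {0..r})" if s: "s \<in> {0..r}" for s
    unfolding m_def
  proof (rule leibniz_rule_vector_derivative[where U="{0..r}"])
    show "(\<lambda>t. P (of_real x * cis t)) integrable_on cbox 0 (2*pi)" if "x \<in> {0..r}" for x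
      unfolding box_real
      by (intro integrable_continuous_real continuous_on_compose2[OF contP])
        (use inside[OF that] in \<open>auto intro!: continuous_intros\<close>)
    show "continuous_on ({0..r} \<times> cbox 0 (2*pi)) (\<lambda>(x, t). cis t *\<^sub>C D (of_real x * cis t))"
      unfolding split_beta
      by (intro scaleC.continuous_on continuous_on_compose2[OF contD])
        (use inside in \<open>auto intro!: continuous_intros\<close>)
  qed (use der_s s in auto)
  have der_m0: "(m has_derivative (\<lambda>h. 0)) (at s within {0..r})" if s: "s \<in> {0..r} - {0}" for s
  proof -
    let ?I = "integral {0..2*pi} (\<lambda>t. cis t *\<^sub>C D (of_real s * cis t))"
    have "((\<lambda>t. (\<i> * of_real s * cis t) *\<^sub>C D (of_real s * cis t)) has_integral
        P (of_real s * cis (2*pi)) - P (of_real s * cis 0)) {0..2*pi}"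
      by (rule fundamental_theorem_of_calculus) (use s in \<open>auto intro!: der_t\<close>)
    then have 0: "((\<lambda>t. (\<i> * of_real s * cis t) *\<^sub>C D (of_real s * cis t)) has_integral 0) {0..2*pi}"
      by simp
    have "(\<lambda>t. cis t *\<^sub>C D (of_real s * cis t)) integrable_on {0..2*pi}"
      by (intro integrable_continuous_real scaleC.continuous_on cont_s)
        (use s in \<open>auto intro!: continuous_intros\<close>)
    then have "((\<lambda>t. (\<i> * of_real s) *\<^sub>C (cis t *\<^sub>C D (of_real s * cis t))) has_integral (\<i> * of_real s) *\<^sub>C ?I) {0..2*pi}"
      by (rule has_integral_linear[OF integrable_integral scaleC.bounded_linear_right, unfolded o_def])
    then have "((\<lambda>t. (\<i> * of_real s * cis t) *\<^sub>C D (of_real s * cis t)) has_integral (\<i> * of_real s) *\<^sub>C ?I) {0..2*pi}"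
      by (simp add: scaleC_scaleC)
    then have "(\<i> * of_real s) *\<^sub>C ?I = 0"
      using 0 by (rule has_integral_unique)
    then have "?I = 0"
      using s by simp
    then show ?thesis
      using der_m[of s] s by (simp add: has_vector_derivative_def)
  qed
  have "m r = 0"
    \<comment> \<open>The periodicity argument divides by \<open>s\<close>, so the derivative at 0 is left out.\<close>
  proof (rule has_derivative_zero_unique_strong_interval[of "{0}" 0 r])
    show "continuous_on {0..r} m"
      by (rule continuous_on_vector_derivative[OF der_m])
    show "m 0 = 0"
      by (simp add: m_def zero)
  qed (use der_m0 r in auto)
  then show ?thesis
    by (simp add: m_def)
qed


text \<open>
  This is the power series expansion \<open>P w = (\<Sum>n. w ^ Suc n * q ^ Suc n)\<close> combined with Cauchy's estimate.
  The expansion need not be summed: taking Fourier coefficients \<open>c n\<close> of \<open>P\<close> on the circle of radius \<open>r\<close>,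
  the equation for \<open>P\<close> becomes the recursion \<open>c (Suc n) = r (\<delta> q + q * c n)\<close>, with \<open>\<delta>\<close> nonzero only for
  \<open>n = 0\<close>. It starts from \<open>c 0 = 0\<close> by the mean value property, and so identifies \<open>c (Suc n)\<close> as a multiple
  of the power of \<open>q\<close> in question.
\<close>
lemma cauchy_estimate_powers:
  fixes q :: "'b::{complex_banach_algebra, comm_ring}"
  assumes P: "\<And>w. cmod w < R \<Longrightarrow> P w = w *\<^sub>C (q + q * P w)" and r: "0 < r" "r < R"
  shows "\<exists>K. \<forall>n. norm (((*) q ^^ n) q) \<le> K / r ^ Suc n"
proof -
  define D where "D w = q + q * P w + q * P w + q * P w * P w" for w
  have der: "(P has_derivative (\<lambda>h. h *\<^sub>C D w)) (at w)" if "cmod w < R" for w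
    unfolding D_def by (rule has_derivative_quasi_resolvent[OF P that])
  have contP: "continuous_on (ball 0 R) P"
    by (intro continuous_at_imp_continuous_on ballI continuous_quasi_resolvent[where R=R and q=q] P) auto
  have contD: "continuous_on (ball 0 R) D"
    unfolding D_def by (intro continuous_intros contP)
  have "P 0 = 0"
    using P[of 0] r by simp
  define p where "p t = P (of_real r * cis t)" for t
  have contp: "continuous_on {0..2*pi} p"
    unfolding p_def
    by (intro continuous_on_compose2[OF contP]) (use r in \<open>auto intro!: continuous_intros simp: norm_mult\<close>)
  define c where "c n = integral {0..2*pi} (\<lambda>t. cis (- (real n * t)) *\<^sub>C p t)" for n
  have integrable: "(\<lambda>t. cis (- (real n * t)) *\<^sub>C p t) integrable_on {0..2*pi}" for n
    by (intro integrable_continuous_real scaleC.continuous_on contp) (auto intro!: continuous_intros)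
  have c0: "c 0 = 0"
    using circle_mean_value_zero[OF der contD \<open>P 0 = 0\<close>, of r] r by (simp add: c_def p_def)
  have p: "p t = (of_real r * cis t) *\<^sub>C (q + q * p t)" for t
    unfolding p_def by (rule P) (use r in \<open>simp add: norm_mult\<close>)
  have pn: "cis (- (real (Suc n) * t)) *\<^sub>C p t =
      of_real r *\<^sub>C (cis (- (real n * t)) *\<^sub>C q + q * (cis (- (real n * t)) *\<^sub>C p t))" for n t
  proof -
    have shift: "cis (- (real (Suc n) * t)) * (of_real r * cis t) = of_real r * cis (- (real n * t))"
      by (simp add: cis_mult algebra_simps)
    then show ?thesis
      by (subst p, subst scaleC_scaleC, subst shift)
        (simp add: scaleC_add_right mult_scaleC_right)
  qed
  have fourier: "((\<lambda>t. cis (- (real n * t))) has_integral (if n = 0 then 2*pi else 0)) {0..2*pi}" for n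
  proof (cases "n = 0")
    case True
    then show ?thesis
      using has_integral_const_real[of "1::complex" 0 "2*pi"] by (simp add: scaleR_conv_of_real)
  next
    case False
    have "((\<lambda>t. cis (- (real n * t))) has_integral
       (\<i> / of_nat n * cis (- (real n * (2*pi))) - \<i> / of_nat n * cis (- (real n * 0)))) {0..2*pi}"
      using False
      by (intro fundamental_theorem_of_calculus)
        (auto intro!: derivative_eq_intros simp: has_vector_derivative_def scaleR_conv_of_real fun_eq_iff field_simps)
    moreover have "cis (- (real n * (2*pi))) = 1"
      using cos_int_2pin[of "int n"] sin_int_2pin[of "int n"] by (simp add: complex_eq_iff mult_ac)
    ultimately show ?thesis
      using False by simp
  qed
  have step: "c (Suc n) = of_real r *\<^sub>C ((if n = 0 then 2*pi else 0) *\<^sub>C q + q * c n)" for n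
  proof -
    have "((\<lambda>t. cis (- (real n * t)) *\<^sub>C q) has_integral (if n = 0 then 2*pi else 0) *\<^sub>C q) {0..2*pi}"
      by (rule has_integral_linear[OF fourier scaleC.bounded_linear_left, unfolded o_def])
    moreover have "((\<lambda>t. q * (cis (- (real n * t)) *\<^sub>C p t)) has_integral q * c n) {0..2*pi}"
      unfolding c_def
      by (rule has_integral_linear[OF integrable_integral bounded_linear_mult_right, unfolded o_def])
        (rule integrable)
    ultimately have "((\<lambda>t. cis (- (real (Suc n) * t)) *\<^sub>C p t) has_integral
        of_real r *\<^sub>C ((if n = 0 then 2*pi else 0) *\<^sub>C q + q * c n)) {0..2*pi}"
      unfolding pn
      by (intro has_integral_linear[OF _ scaleC.bounded_linear_right, unfolded o_def] has_integral_add)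
    then show ?thesis
      unfolding c_def by (rule integral_unique)
  qed
  have c_Suc: "c (Suc n) = (2 * pi * r ^ Suc n) *\<^sub>R (((*) q ^^ n) q)" for n
  proof (induction n)
    case 0
    then show ?case
      by (simp add: step c0 scaleC_scaleC mult_ac flip: scaleC_of_real)
  next
    case (Suc n)
    then show ?case
      by (subst step) (simp add: scaleC_of_real)
  qed
  have "compact (p ` {0..2*pi})"
    by (rule compact_continuous_image[OF contp]) simp
  then obtain K where K: "\<And>t. t \<in> {0..2*pi} \<Longrightarrow> norm (p t) \<le> K"
    by (meson bounded_iff compact_imp_bounded image_eqI)
  show ?thesis
  proof (intro exI allI)
    fix n
    have "norm (c (Suc n)) \<le> K * (2*pi - 0)"
      unfolding c_def
      by (rule integral_bound)
        (auto intro!: scaleC.continuous_on contp continuous_intros simp: norm_scaleC K)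
    then have "2 * pi * (r ^ Suc n * norm (((*) q ^^ n) q)) \<le> 2 * pi * K"
      using r by (simp add: c_Suc mult_ac)
    then have "r ^ Suc n * norm (((*) q ^^ n) q) \<le> K"
      by (rule mult_left_le_imp_le) simp
    then show "norm (((*) q ^^ n) q) \<le> K / r ^ Suc n"
      using r by (simp add: field_simps)
  qed
qed

section \<open>Neumann series\<close>

lemma neumann_series:
  fixes h z :: "'a::{real_normed_algebra, banach}"
  assumes "summable (\<lambda>n. ((*) h ^^ n) z)"
  shows "\<exists>v. v - h * v = z"
proof
  let ?v = "\<Sum>n. ((*) h ^^ n) z"
  have "h * ?v = (\<Sum>n. h * ((*) h ^^ n) z)"
    by (rule suminf_mult[OF assms, symmetric])
  also have "\<dots> = ?v - z"
    using suminf_split_head[OF assms] by simp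
  finally show "?v - h * ?v = z" by simp
qed

lemma norm_iterated_mult_le:
  fixes h z :: "'a::real_normed_algebra"
  shows "norm (((*) h ^^ n) z) \<le> norm h ^ n * norm z"
proof (induction n)
  case (Suc n)
  have "norm (h * ((*) h ^^ n) z) \<le> norm h * norm (((*) h ^^ n) z)"
    by (rule norm_mult_ineq)
  also have "\<dots> \<le> norm h * (norm h ^ n * norm z)"
    by (intro mult_left_mono Suc) simp
  finally show ?case by (simp add: mult_ac)
qed simp

lemma quasi_invertible_of_norm_less_1:
  fixes h z :: "'a::{real_normed_algebra, banach}"
  assumes "norm h < 1"
  shows "\<exists>v. v - h * v = z"
proof (rule neumann_series, rule summable_comparison_test')
  show "summable (\<lambda>n. norm h ^ n * norm z)"
    using assms by (intro summable_mult2 summable_geometric) simp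
qed (rule norm_iterated_mult_le)

lemma iterated_mult_distrib:
  fixes x y z w :: "'a::comm_ring"
  shows "((*) (x * y) ^^ n) (z * w) = ((*) x ^^ n) z * ((*) y ^^ n) w"
  by (induction n) (simp_all add: mult_ac)

text \<open>
  The bound on the powers of \<open>x * x\<close> makes the Neumann series for \<open>1 - x * x * (g * g)\<close> converge, and
  \<open>1 - h * h = (1 - h) * (1 + h)\<close> passes from \<open>x * x * (g * g)\<close> to \<open>h = x * g\<close>.
\<close>
lemma surj_one_minus_of_square_powers:
  fixes x g :: "'b::{complex_banach_algebra, comm_ring}"
  assumes K: "\<And>n. norm (((*) (x * x) ^^ n) (x * x)) \<le> K / r ^ Suc n" and r: "0 < r"
    and g: "norm g * norm g < r"
  shows "\<exists>y. y - x * g * y = z"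
proof -
  define s where "s = norm g * norm g"
  have s: "0 \<le> s" "s < r"
    using g by (auto simp: s_def)
  have "\<exists>v. v - (x * x * (g * g)) * v = z"
  proof (rule neumann_series, subst summable_Suc_iff[symmetric], rule summable_comparison_test')
    show "summable (\<lambda>n. (K / r * norm (g * g * z)) * (s / r) ^ n)"
      using s by (intro summable_mult summable_geometric) simp
    fix n
    have "((*) (x * x * (g * g)) ^^ Suc n) z = ((*) (x * x * (g * g)) ^^ n) ((x * x) * (g * g * z))"
      by (simp add: funpow_swap1 mult.assoc)
    also have "\<dots> = ((*) (x * x) ^^ n) (x * x) * ((*) (g * g) ^^ n) (g * g * z)"
      by (rule iterated_mult_distrib)
    finally have "norm (((*) (x * x * (g * g)) ^^ Suc n) z) \<le>
        norm (((*) (x * x) ^^ n) (x * x)) * norm (((*) (g * g) ^^ n) (g * g * z))"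
      by (metis norm_mult_ineq)
    also have "\<dots> \<le> K / r ^ Suc n * (s ^ n * norm (g * g * z))"
    proof (intro mult_mono K)
      have "norm (((*) (g * g) ^^ n) (g * g * z)) \<le> norm (g * g) ^ n * norm (g * g * z)"
        by (rule norm_iterated_mult_le)
      also have "\<dots> \<le> s ^ n * norm (g * g * z)"
        unfolding s_def by (intro mult_right_mono power_mono norm_mult_ineq) auto
      finally show "norm (((*) (g * g) ^^ n) (g * g * z)) \<le> s ^ n * norm (g * g * z)" .
      show "0 \<le> K / r ^ Suc n"
        using K[of n] norm_ge_zero by (rule order_trans[rotated])
    qed simp
    finally show "norm (((*) (x * x * (g * g)) ^^ Suc n) z) \<le> (K / r * norm (g * g * z)) * (s / r) ^ n"
      by (simp add: power_divide mult_ac)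
  qed
  then obtain v where v: "v - (x * x * (g * g)) * v = z" by blast
  have "(v + x * g * v) - x * g * (v + x * g * v) = z"
    using v by (simp add: algebra_simps)
  then show ?thesis by blast
qed

section \<open>The closed graph theorem\<close>

lemma ex_interior_of_countable_closed_cover:
  fixes F :: "nat \<Rightarrow> 'a::banach set"
  assumes closed: "\<And>n. closed (F n)" and cover: "(\<Union>n. F n) = UNIV"
  obtains n where "interior (F n) \<noteq> {}"
proof -
  have "completely_metrizable_space (euclidean :: 'a topology)"
    by (rule completely_metrizable_space_euclidean)
  then have "euclidean interior_of \<Union>(range F) = {}" if "\<And>n. interior (F n) = {}"
    using that closed by (intro Baire_category_alt) auto
  then show thesis
    using that cover by force
qed

text \<open>
  By Baire's theorem, some set \<open>{x. norm (f x) \<le> n}\<close> is dense in a ball; taking differences and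
  rescaling, every \<open>x\<close> is approximated arbitrarily well by some \<open>w\<close> with \<open>norm (f w) \<le> L * norm x\<close>.
  Repeatedly approximating the remaining error writes \<open>x\<close> as a series whose image under \<open>f\<close> converges
  absolutely, and the hypothesis of a closed graph says that the image series has sum \<open>f x\<close>.
\<close>
lemma closed_graph_theorem:
  fixes f :: "'a::banach \<Rightarrow> 'b::banach"
  assumes "linear f"
    and closed: "\<And>X y. X \<longlonglongrightarrow> 0 \<Longrightarrow> (\<lambda>n. f (X n)) \<longlonglongrightarrow> y \<Longrightarrow> y = 0"
  shows "bounded_linear f"
proof -
  interpret linear f by fact
  define F where "F n = closure {x. norm (f x) \<le> real n}" for n :: nat
  have "x \<in> (\<Union>n. F n)" for x
    using closure_subset real_arch_simple[of "norm (f x)"] by (fastforce simp: F_def)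
  then have "(\<Union>n. F n) = UNIV"
    by blast
  moreover have "closed (F n)" for n
    by (simp add: F_def)
  ultimately obtain n where "interior (F n) \<noteq> {}"
    using ex_interior_of_countable_closed_cover by metis
  then obtain x0 d where d: "0 < d" and "ball x0 d \<subseteq> F n"
    by (metis all_not_in_conv mem_interior)
  then have near: "\<exists>u. dist u x < e \<and> norm (f u) \<le> real n" if "dist x0 x < d" "0 < e" for x e
    using that unfolding F_def closure_approachable subset_iff by auto
  define L where "L = 2 * (2 * real n) / d"
  have approx: "\<exists>w. norm (x - w) < e \<and> norm (f w) \<le> L * norm x" if "0 < e" for x e
  proof (cases "x = 0")
    case True
    then show ?thesis
      using that by (intro exI[of _ 0]) (simp add: zero)
  next
    case False
    \<comment> \<open>The factor \<open>s\<close> moves \<open>x\<close> into the ball of radius \<open>d\<close> around 0.\<close>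
    define s where "s = d / (2 * norm x)"
    have s: "0 < s" and sx: "norm (s *\<^sub>R x) < d"
      using False d by (auto simp: s_def)
    have se: "0 < s * e"
      using s that by simp
    obtain u where u: "dist u (x0 + s *\<^sub>R x) < s * e / 2" "norm (f u) \<le> real n"
      using near[of "x0 + s *\<^sub>R x" "s * e / 2"] sx se by (auto simp: dist_norm)
    obtain v where v: "dist v x0 < s * e / 2" "norm (f v) \<le> real n"
      using near[of x0 "s * e / 2"] d se by auto
    let ?w = "(u - v) /\<^sub>R s"
    have "norm (s *\<^sub>R x - (u - v)) = norm ((v - x0) - (u - (x0 + s *\<^sub>R x)))"
      by (simp add: algebra_simps)
    also have "\<dots> < s * e"
      using u(1) v(1) norm_triangle_ineq4[of "v - x0" "u - (x0 + s *\<^sub>R x)"] by (simp add: dist_norm)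
    finally have "norm (s *\<^sub>R x - (u - v)) < s * e" .
    moreover have "s *\<^sub>R (x - ?w) = s *\<^sub>R x - (u - v)"
      using s by (simp add: scaleR_right_diff_distrib)
    then have "s * norm (x - ?w) = norm (s *\<^sub>R x - (u - v))"
      using s by (metis norm_scaleR abs_of_pos)
    ultimately have "norm (x - ?w) < e"
      using s by (metis mult_less_cancel_left_pos)
    have "norm (f (u - v)) \<le> 2 * real n"
      using u(2) v(2) norm_triangle_ineq4[of "f u" "f v"] by (simp add: diff)
    then have "norm (f (u - v)) / s \<le> 2 * real n / s"
      using s by (intro divide_right_mono) auto
    moreover have "norm (f ?w) = norm (f (u - v)) / s"
      using s unfolding scaleR norm_scaleR by (simp add: divide_inverse mult.commute)
    moreover have "2 * real n / s = L * norm x"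
      by (simp add: L_def s_def)
    ultimately have "norm (f ?w) \<le> L * norm x"
      by simp
    with \<open>norm (x - ?w) < e\<close> show ?thesis
      by blast
  qed
  have "norm (f x) \<le> norm x * (2 * L)" for x
  proof (cases "x = 0")
    case False
    obtain W where W: "\<And>k z. norm (z - W k z) < norm x / 2 ^ Suc k" "\<And>k z. norm (f (W k z)) \<le> L * norm z"
      using approx[of "norm x / 2 ^ Suc k" for k] False by simp metis
    \<comment> \<open>\<open>X k\<close> is the error that is left after \<open>k\<close> approximations.\<close>
    define X where "X = rec_nat x (\<lambda>k z. z - W k z)"
    have X: "X 0 = x" "X (Suc k) = X k - W k (X k)" for k
      by (simp_all add: X_def)
    have X_le: "norm (X k) \<le> norm x / 2 ^ k" for k
      by (cases k) (simp_all add: X less_imp_le[OF W(1)] del: power_Suc)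
    have "norm (f (W k (X k))) \<le> (L * norm x) * (1/2) ^ k" for k
    proof -
      have "L * norm (X k) \<le> L * (norm x / 2 ^ k)"
        using d by (intro mult_left_mono X_le) (simp add: L_def)
      then show ?thesis
        using W(2)[of k "X k"] by (simp add: power_one_over)
    qed
    moreover have geo: "(\<lambda>k. (L * norm x) * (1/2) ^ k) sums ((L * norm x) * 2)"
      using geometric_sums[of "1/2::real"] by (intro sums_mult) simp
    ultimately have sm: "summable (\<lambda>k. norm (f (W k (X k))))"
      by (intro summable_comparison_test'[OF sums_summable[OF geo]]) simp
    let ?y = "\<Sum>k. f (W k (X k))"
    have "norm ?y \<le> (\<Sum>k. norm (f (W k (X k))))"
      by (rule summable_norm[OF sm])
    also have "\<dots> \<le> (L * norm x) * 2"
      unfolding sums_unique[OF geo] by (intro suminf_le sm sums_summable[OF geo]) fact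
    finally have y: "norm ?y \<le> norm x * (2 * L)"
      by (simp add: mult_ac)
    have fX: "f (X k) = f x - (\<Sum>j<k. f (W j (X j)))" for k
      by (induction k) (simp_all add: X diff)
    have "X \<longlonglongrightarrow> 0"
    proof (rule Lim_null_comparison)
      show "(\<lambda>k. norm x / 2 ^ k) \<longlonglongrightarrow> 0"
        by (rule LIMSEQ_divide_realpow_zero) simp
    qed (use X_le in auto)
    moreover have "(\<lambda>k. f (X k)) \<longlonglongrightarrow> f x - ?y"
      unfolding fX by (intro tendsto_intros summable_LIMSEQ summable_norm_cancel[OF sm])
    ultimately have "f x - ?y = 0"
      by (rule closed)
    with y show ?thesis by simp
  qed (simp add: zero)
  then show ?thesis
    by (intro bounded_linear_intro[where K="2*L"]) (auto simp: add scaleR)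
qed

section \<open>Mixed Jordan homomorphisms and maximal modular ideals\<close>

text \<open>
  Take a square root \<open>\<mu>\<close> of \<open>w\<close> and \<open>h = \<mu> a\<close>. As \<open>h * h\<close> has norm less than 1, \<open>a = b - h * h * b\<close> for some \<open>b\<close>,
  and applying \<open>\<phi>\<close> gives \<open>\<phi> a = (1 - w q) * \<phi> b\<close> with \<open>q = \<phi> a * \<phi> a\<close>. Multiplying by \<open>w \<phi> a\<close> shows
  \<open>w q = (1 - w q) * p\<close> for \<open>p = w (\<phi> a * \<phi> b)\<close>.
\<close>
lemma mixed_jordan_quasi_inverse:
  fixes \<phi> :: "'a::complex_banach_algebra \<Rightarrow> 'b::{complex_banach_algebra, comm_ring}"
  assumes \<phi>: "mixed_jordan_homomorphism \<phi>" and w: "cmod w * (norm a * norm a) < 1"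
  shows "\<exists>p. p = w *\<^sub>C (\<phi> a * \<phi> a + \<phi> a * \<phi> a * p)"
proof -
  have lin: "Vector_Spaces.linear scaleC scaleC \<phi>" and mult: "\<And>a b. \<phi> (a * a * b) = \<phi> a * \<phi> a * \<phi> b"
    using \<phi> by (auto simp: mixed_jordan_homomorphism_def)
  define h where "h = csqrt w *\<^sub>C a"
  have csqrt: "csqrt w * csqrt w = w"
    by (metis power2_csqrt power2_eq_square)
  have hh: "h * h = w *\<^sub>C (a * a)"
    by (simp add: h_def mult_scaleC_left mult_scaleC_right scaleC_scaleC csqrt)
  have "norm (h * h) \<le> cmod w * (norm a * norm a)"
    unfolding hh norm_scaleC by (intro mult_left_mono norm_mult_ineq) auto
  then obtain b where b: "b - h * h * b = a"
    using quasi_invertible_of_norm_less_1[of "h * h" a] w by auto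
  have "\<phi> h * \<phi> h = w *\<^sub>C (\<phi> a * \<phi> a)"
    by (simp add: h_def Vector_Spaces.linear_iff[THEN iffD1, OF lin] mult_scaleC_left mult_scaleC_right scaleC_scaleC csqrt)
  then have a: "\<phi> a = \<phi> b - w *\<^sub>C (\<phi> a * \<phi> a) * \<phi> b"
    using mult[of h b] by (metis b vector_space_pair.linear_diff[OF _ lin] complex_vector.vector_space_axioms vector_space_pair.intro)
  then have "\<phi> b = \<phi> a + w *\<^sub>C (\<phi> a * \<phi> a) * \<phi> b"
    by (simp add: algebra_simps)
  then have "w *\<^sub>C (\<phi> a * \<phi> b) = w *\<^sub>C (\<phi> a * (\<phi> a + w *\<^sub>C (\<phi> a * \<phi> a) * \<phi> b))"
    by (rule arg_cong[where f="\<lambda>t. w *\<^sub>C (\<phi> a * t)"])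
  also have "\<dots> = w *\<^sub>C (\<phi> a * \<phi> a + \<phi> a * \<phi> a * (w *\<^sub>C (\<phi> a * \<phi> b)))"
    by (simp add: distrib_left mult.assoc mult_scaleC_left mult_scaleC_right)
  finally show ?thesis ..
qed

text \<open>
  Modulo \<open>M\<close> the algebra is a field in which \<open>b\<close> is nonzero, so \<open>b\<close> has an inverse \<open>d\<close> there.
  Concretely, the ideal generated by \<open>M\<close>
  and \<open>b\<close> is the whole algebra, hence contains a modular unit \<open>u\<close>, and \<open>u = m + d * b\<close> with \<open>m\<close> in \<open>M\<close>.
\<close>
lemma invertible_modulo_maximal_ideal:
  fixes M :: "'b::{complex_banach_algebra, comm_ring} set"
  assumes M: "maximal_modular_left_ideal M" and b: "b \<notin> M"
  obtains d where "\<And>y. y - b * d * y \<in> M"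
proof -
  have sub: "complex_vector.subspace M" and ideal: "\<And>a x. x \<in> M \<Longrightarrow> a * x \<in> M"
    and max: "\<And>I. left_ideal I \<Longrightarrow> M \<subseteq> I \<Longrightarrow> I = M \<or> I = UNIV"
    using M by (auto simp: maximal_modular_left_ideal_def modular_left_ideal_def left_ideal_def)
  obtain u where u: "\<And>a. a - a * u \<in> M"
    using M by (auto simp: maximal_modular_left_ideal_def modular_left_ideal_def)
  define I where "I = {m + d * b |m d. m \<in> M}"
  have add: "m + m' \<in> M" and scale: "c *\<^sub>C m \<in> M" if "m \<in> M" "m' \<in> M" for m m' c
    using sub that by (auto simp: complex_vector.subspace_def)
  have "0 \<in> M"
    using sub by (rule complex_vector.subspace_0)
  have "left_ideal I"
    unfolding left_ideal_def complex_vector.subspace_def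
  proof (intro conjI allI ballI)
    have "0 + 0 * b \<in> I" using \<open>0 \<in> M\<close> unfolding I_def by blast
    then show "0 \<in> I" by simp
    fix x assume "x \<in> I"
    then obtain m d where x: "x = m + d * b" "m \<in> M" by (auto simp: I_def)
    show "x + y \<in> I" if y: "y \<in> I" for y
    proof -
      obtain m' d' where "y = m' + d' * b" "m' \<in> M" using y by (auto simp: I_def)
      then have "x + y = (m + m') + (d + d') * b" "m + m' \<in> M"
        using x add by (auto simp: algebra_simps)
      then show ?thesis unfolding I_def by blast
    qed
    have "c *\<^sub>C x = c *\<^sub>C m + (c *\<^sub>C d) * b" "c *\<^sub>C m \<in> M" for c
      using x scale by (auto simp: scaleC_add_right mult_scaleC_left)
    then show "c *\<^sub>C x \<in> I" for c unfolding I_def by blast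
    have "a * x = a * m + (a * d) * b" "a * m \<in> M" for a
      using x ideal by (auto simp: distrib_left mult.assoc)
    then show "a * x \<in> I" for a unfolding I_def by blast
  qed
  moreover have "M \<subseteq> I"
  proof
    fix m assume "m \<in> M"
    then have "m + 0 * b \<in> I" unfolding I_def by blast
    then show "m \<in> I" by simp
  qed
  moreover have "I \<noteq> M"
  proof
    assume "I = M"
    moreover have "0 + u * b \<in> I" using \<open>0 \<in> M\<close> unfolding I_def by blast
    ultimately have "u * b \<in> M" by simp
    then have "(b - b * u) + u * b \<in> M" using u add by blast
    with b show False by (simp add: mult.commute)
  qed
  ultimately have "u \<in> I" using max by blast
  then obtain m d where d: "u = m + d * b" "m \<in> M" by (auto simp: I_def)
  have "y - b * d * y \<in> M" for y
  proof -
    have "(y - y * u) + y * m \<in> M" using u ideal[OF d(2)] add by blast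
    moreover have "(y - y * u) + y * m = y - b * d * y" by (simp add: d(1) algebra_simps)
    ultimately show ?thesis by simp
  qed
  then show thesis by (rule that)
qed

lemma separating_space_subset_maximal_modular_ideal:
  fixes \<phi> :: "'a::complex_banach_algebra \<Rightarrow> 'b::{complex_banach_algebra, comm_ring}"
  assumes \<phi>: "mixed_jordan_homomorphism \<phi>"
    and X: "X \<longlonglongrightarrow> 0" "(\<lambda>n. \<phi> (X n)) \<longlonglongrightarrow> b"
    and M: "maximal_modular_left_ideal M"
  shows "b \<in> M"
proof (rule ccontr)
  assume "b \<notin> M"
  then obtain d where d: "\<And>y. y - b * d * y \<in> M"
    using invertible_modulo_maximal_ideal[OF M] by blast
  \<comment> \<open>\<open>s\<close> will be an upper bound for \<open>norm g * norm g\<close>. The powers of \<open>x * x\<close> must decay fast enough to make up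
    for the powers of \<open>s\<close>, so the Cauchy estimate is used on radius \<open>s + 1\<close>, inside a disc of radius \<open>s + 2\<close>.\<close>
  define s where "s = (2 * norm d) * (2 * norm d)"
  have "0 \<le> s" by (simp add: s_def)
  have "(\<lambda>n. (s + 2) * (norm (X n) * norm (X n))) \<longlonglongrightarrow> (s + 2) * (norm (0::'a) * norm (0::'a))"
    by (intro tendsto_intros X)
  then have ev1: "\<forall>\<^sub>F n in sequentially. (s + 2) * (norm (X n) * norm (X n)) < 1"
    by (rule order_tendstoD) simp
  have "(\<lambda>n. norm (b - \<phi> (X n)) * norm d) \<longlonglongrightarrow> norm (b - b) * norm d"
    by (intro tendsto_intros X)
  then have ev2: "\<forall>\<^sub>F n in sequentially. norm (b - \<phi> (X n)) * norm d < 1/2"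
    by (rule order_tendstoD) simp
  obtain n where n: "(s + 2) * (norm (X n) * norm (X n)) < 1" "norm (b - \<phi> (X n)) * norm d < 1/2"
    using eventually_happens[OF eventually_conj[OF ev1 ev2]] by auto
  define x e where "x = \<phi> (X n)" and "e = b - x"
  have "\<exists>p. p = w *\<^sub>C (x * x + x * x * p)" if "cmod w < s + 2" for w
  proof -
    have "cmod w * (norm (X n) * norm (X n)) \<le> (s + 2) * (norm (X n) * norm (X n))"
      using that by (intro mult_right_mono) auto
    then show ?thesis
      using mixed_jordan_quasi_inverse[OF \<phi>, of w "X n"] n(1) unfolding x_def by (meson le_less_trans)
  qed
  then obtain P where P: "\<And>w. cmod w < s + 2 \<Longrightarrow> P w = w *\<^sub>C (x * x + x * x * P w)"
    by metis
  have s1: "0 < s + 1" "s + 1 < s + 2"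
    using \<open>0 \<le> s\<close> by auto
  obtain K where K: "\<And>n. norm (((*) (x * x) ^^ n) (x * x)) \<le> K / (s + 1) ^ Suc n"
    using cauchy_estimate_powers[OF P s1] by auto
  have ed: "norm (e * d) < 1/2"
    using n(2) norm_mult_ineq[of e d] unfolding e_def x_def by linarith
  then obtain g where g: "g - e * d * g = d"
    using quasi_invertible_of_norm_less_1[of "e * d" d] by auto
  have "norm (e * d * g) \<le> 1/2 * norm g"
    using norm_mult_ineq[of "e * d" g] mult_right_mono[OF less_imp_le[OF ed] norm_ge_zero[of g]]
    by linarith
  then have "norm g \<le> 2 * norm d"
    using norm_triangle_ineq2[of g "e * d * g"] unfolding g by linarith
  then have "norm g * norm g \<le> s"
    unfolding s_def by (intro mult_mono) auto
  then have g_less: "norm g * norm g < s + 1" by simp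
  have "z \<in> M" for z
  proof -
    obtain v where v: "v - e * d * v = z"
      using quasi_invertible_of_norm_less_1[of "e * d" z] ed by auto
    from surj_one_minus_of_square_powers[OF K s1(1) g_less] obtain y where y: "y - x * g * y = v" ..
    have "z = y - e * d * y - x * (g - e * d * g) * y"
      unfolding v[symmetric] y[symmetric] by (simp add: algebra_simps)
    also have "\<dots> = y - (x + e) * d * y"
      unfolding g by (simp add: algebra_simps)
    also have "x + e = b"
      by (simp add: e_def)
    finally show ?thesis using d by simp
  qed
  then show False
    using M by (auto simp: maximal_modular_left_ideal_def)
qed

theorem corollary2p11:
  fixes \<phi> :: "'a::complex_banach_algebra \<Rightarrow> 'b::{complex_banach_algebra, comm_ring}"
  assumes "semisimple TYPE('b)"
    and "mixed_jordan_homomorphism \<phi>"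
  shows "continuous_on UNIV \<phi>"
proof -
  have lin: "Vector_Spaces.linear scaleC scaleC \<phi>"
    using assms(2) by (simp add: mixed_jordan_homomorphism_def)
  have "linear \<phi>"
    using Vector_Spaces.linear_iff[THEN iffD1, OF lin]
    by (intro linearI) (simp_all flip: scaleC_of_real)
  then have "bounded_linear \<phi>"
  proof (rule closed_graph_theorem)
    fix X b assume "X \<longlonglongrightarrow> 0" "(\<lambda>n. \<phi> (X n)) \<longlonglongrightarrow> b"
    then have "b \<in> jacobson_radical"
      using separating_space_subset_maximal_modular_ideal[OF assms(2)]
      by (auto simp: jacobson_radical_def)
    then show "b = 0"
      using assms(1) unfolding semisimple_def by blast
  qed
  then show ?thesis
    by (rule linear_continuous_on)
qed

end
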